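(* For any partition $\pi$ of the $n$-element set $\{1,\dots,n\}$, $n\ge1$, $$\deg\Sigma_\pi=n-2\,\mathrm{genus}_\pi .$$ Here $\deg\Sigma_\pi=(k_1+1)+\cdots+(k_t+1)$, where $\Sigma_\pi=\Sigma_{k_1,\dots,k_t}$ is the normalized conjugacy class indicator assigned to $\pi$.
   Context: Let $\pi$ be a partition of $\{1,\dots,n\}$ with $r$ blocks. For a block with elements $x_1<\dots<x_l$ put $\pi_{\mathrm{fat}}(x_i')=x_{i+1}$ (with $x_{l+1}=x_1$); this defines a bijection $\pi_{\mathrm{fat}}:\{1',\dots,n'\}\to\{1,\dots,n\}$, equivalently a pair partition of $\{1,1',2,2',\dots,n,n'\}$. Let $c:\{1,\dots,n\}\to\{1',\dots,n'\}$, $c(k)=(k-1)'$ for $k\ge2$, $c(1)=n'$. Decompose the permutation $\pi_{\mathrm{fat}}\circ c$ of $\{1,\dots,n\}$ into disjoint cycles $b_1,\dots,b_t$ (fixed points included), $b_s=(b_{s,1},\dots,b_{s,j_s})$ where $b_{s,i}\mapsto b_{s,i+1}$ and $b_{s,j_s+1}=b_{s,1}$. The number of clockwise winds of $b_s$ is the number of $1\le i\le j_s$ with $b_{s,i}\le b_{s,i+1}$; put $k_s=j_s-(\text{number of clockwise winds of }b_s)$. One sets $\Sigma_\pi:=\Sigma_{k_1,\dots,k_t}$, where $\Sigma_{k_1,\dots,k_t}$ is the normalized indicator of the class of (partial) permutations with cycle lengths $k_1,\dots,k_t$, whose degree in the filtration used is declared to be $(k_1+1)+\cdots+(k_t+1)$.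 Genus: take a sphere with a circular hole whose boundary carries, counterclockwise, the points $1,1',2,2',\dots,n,n'$, and join pairs of these points by lines according to $\pi_{\mathrm{fat}}$. For each block of $\pi$ glue a disc along the lines of $\pi_{\mathrm{fat}}$ coming from that block and the arcs between $k$ and $k'$ for $k$ in the block; the remaining boundary components correspond to the cycles of $\pi_{\mathrm{fat}}\circ c$, and one glues a disc to each of them. The result is a closed orientable surface and $\mathrm{genus}_\pi$ is its genus. The resulting polyhedron has $2n$ vertices, $3n$ edges and $1+r+t$ faces, so $\mathrm{genus}_\pi=\frac{n+1-r-t}{2}$. *)

theory Defs
  imports
    Complex_Main
    "HOL-Library.Disjoint_Sets"
    "HOL-Library.Multiset"
    "HOL-Combinatorics.Orbits"
begin

section \<open>The fat partition and the cycles of its composition with the shift\<close>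

text \<open>A partition of \<open>{1..n}\<close> is a set of blocks \<open>P\<close> with \<open>partition_on {1..n} P\<close>.
  The primed copies of the integers have their own type.\<close>

datatype primed = Prime nat

definition block_of :: "nat set set \<Rightarrow> nat \<Rightarrow> nat set" where
  "block_of P x = (THE B. B \<in> P \<and> x \<in> B)"

text \<open>For \<open>B = {x\<^sub>1 < \<dots> < x\<^sub>l}\<close> this maps \<open>x\<^sub>i\<close> to \<open>x\<^bsub>i+1\<^esub>\<close> and \<open>x\<^sub>l\<close> to \<open>x\<^sub>1\<close>.\<close>

definition cyclic_succ :: "nat set \<Rightarrow> nat \<Rightarrow> nat" where
  "cyclic_succ B x = (if \<exists>y\<in>B. x < y then Min {y \<in> B. x < y} else Min B)"

fun pi_fat :: "nat set set \<Rightarrow> primed \<Rightarrow> nat" where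
  "pi_fat P (Prime k) = cyclic_succ (block_of P k) k"

definition shift :: "nat \<Rightarrow> nat \<Rightarrow> primed" where
  "shift n k = (if k = 1 then Prime n else Prime (k - 1))"

definition orbits_on :: "('a \<Rightarrow> 'a) \<Rightarrow> 'a set \<Rightarrow> 'a set set" where
  "orbits_on f A = orbit f ` A"

definition fat_cycles :: "nat \<Rightarrow> nat set set \<Rightarrow> nat set set" where
  "fat_cycles n P = orbits_on (pi_fat P \<circ> shift n) {1..n}"

text \<open>The entries \<open>b\<^bsub>s,i\<^esub>\<close> of a cycle are pairwise distinct and \<open>b\<^bsub>s,i+1\<^esub>\<close> is the image of
  \<open>b\<^bsub>s,i\<^esub>\<close>, so that counting indices \<open>i\<close> is counting elements of the cycle.\<close>

definition clockwise_winds :: "nat \<Rightarrow> nat set set \<Rightarrow> nat set \<Rightarrow> nat" where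
  "clockwise_winds n P b = card {x \<in> b. x \<le> (pi_fat P \<circ> shift n) x}"

definition cycle_index :: "nat \<Rightarrow> nat set set \<Rightarrow> nat set \<Rightarrow> nat" where
  "cycle_index n P b = card b - clockwise_winds n P b"


section \<open>Normalized indicators and their degree\<close>

text \<open>The symbol \<open>\<Sigma>\<close> with indices \<open>k\<^sub>1, \<dots>, k\<^sub>t\<close>, whose order is irrelevant. It is kept as a symbol,
  because its degree is declared in terms of the indices, each of which contributes \<open>k\<^sub>s + 1\<close>;
  indices \<open>0\<close> occur and contribute \<open>1\<close>.\<close>

datatype class_indicator = Class_Indicator "nat multiset"

fun deg :: "class_indicator \<Rightarrow> nat" where
  "deg (Class_Indicator K) = (\<Sum>k\<in>#K. k + 1)"

definition indicator_of_partition :: "nat \<Rightarrow> nat set set \<Rightarrow> class_indicator" where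
  "indicator_of_partition n P =
     Class_Indicator (image_mset (cycle_index n P) (mset_set (fat_cycles n P)))"


section \<open>The surface of a partition and its genus\<close>

text \<open>
  A cell decomposition of a closed oriented surface is given by its set \<open>D\<close> of oriented edges,
  the map \<open>e\<close> reversing an oriented edge, and the map \<open>f\<close> sending an oriented edge to the next one
  along the boundary of the face on its left. Edges are the orbits of \<open>e\<close>, faces those of \<open>f\<close>, and
  vertices those of \<open>f \<circ> e\<close>, which runs through the oriented edges with a given origin.
\<close>

definition euler_characteristic :: "('d \<Rightarrow> 'd) \<Rightarrow> ('d \<Rightarrow> 'd) \<Rightarrow> 'd set \<Rightarrow> int" where
  "euler_characteristic e f D =
     int (card (orbits_on (f \<circ> e) D)) - int (card (orbits_on e D)) + int (card (orbits_on f D))"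

text \<open>
  The vertices of the polyhedron of a partition are the points \<open>1, 1', \<dots>, n, n'\<close>. Each vertex lies on
  one edge of each of three kinds:
  \<^item> \<open>Block_Arc\<close>, the arc of the boundary of the hole between \<open>k\<close> and \<open>k'\<close>;
  \<^item> \<open>Gap_Arc\<close>, the arc between \<open>k'\<close> and \<open>k + 1\<close> (between \<open>n'\<close> and \<open>1\<close> for \<open>k = n\<close>);
  \<^item> \<open>Line\<close>, the line between \<open>k'\<close> and its image under \<open>pi_fat\<close>.
  An oriented edge is a pair of its origin and its kind.
\<close>

type_synonym point = "nat + primed"

datatype edge_kind = Block_Arc | Gap_Arc | Line

definition oriented_edges :: "nat \<Rightarrow> (point \<times> edge_kind) set" where
  "oriented_edges n = ({1..n} <+> Prime ` {1..n}) \<times> {Block_Arc, Gap_Arc, Line}"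

fun opposite_end :: "nat \<Rightarrow> nat set set \<Rightarrow> edge_kind \<Rightarrow> point \<Rightarrow> point" where
  "opposite_end n P Block_Arc (Inl k) = Inr (Prime k)"
| "opposite_end n P Block_Arc (Inr (Prime k)) = Inl k"
| "opposite_end n P Gap_Arc (Inl k) = Inr (shift n k)"
| "opposite_end n P Gap_Arc (Inr (Prime k)) = Inl (if k = n then 1 else k + 1)"
| "opposite_end n P Line (Inl k) = Inr (inv_into (Prime ` {1..n}) (pi_fat P) k)"
| "opposite_end n P Line (Inr p) = Inl (pi_fat P p)"

fun reverse_edge :: "nat \<Rightarrow> nat set set \<Rightarrow> point \<times> edge_kind \<Rightarrow> point \<times> edge_kind" where
  "reverse_edge n P (p, a) = (opposite_end n P a p, a)"

text \<open>
  The kind of the edge leaving the vertex \<open>q\<close> along the boundary of a face that arrives at \<open>q\<close> by an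
  edge of kind \<open>a\<close>. There are three sorts of faces, and every edge is traversed once in each
  direction:
  \<^item> the sphere with a hole, bounded by \<open>1 \<rightarrow> 1' \<rightarrow> 2 \<rightarrow> \<dots> \<rightarrow> n' \<rightarrow> 1\<close>, where both kinds of arcs alternate;
  \<^item> for each block, the disc bounded by the arcs \<open>k' \<rightarrow> k\<close>, for \<open>k\<close> in the block, and by the lines,
    from unprimed to primed points;
  \<^item> the remaining discs, bounded by the arcs \<open>k \<rightarrow> shift n k\<close> and by the lines, from primed to
    unprimed points.
\<close>

fun turn :: "point \<Rightarrow> edge_kind \<Rightarrow> edge_kind" where
  "turn (Inr p) Block_Arc = Gap_Arc"
| "turn (Inl k) Gap_Arc = Block_Arc"
| "turn (Inl k) Block_Arc = Line"
| "turn (Inr p) Line = Block_Arc"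
| "turn (Inr p) Gap_Arc = Line"
| "turn (Inl k) Line = Gap_Arc"

fun next_edge :: "nat \<Rightarrow> nat set set \<Rightarrow> point \<times> edge_kind \<Rightarrow> point \<times> edge_kind" where
  "next_edge n P (p, a) = (let q = opposite_end n P a p in (q, turn q a))"

text \<open>The surface is connected, since the boundary of the hole passes through all vertices. A closed
  connected orientable surface of genus \<open>g\<close> has Euler characteristic \<open>2 - 2 * g\<close>.\<close>

definition genus :: "nat \<Rightarrow> nat set set \<Rightarrow> real" where
  "genus n P =
     (2 - of_int (euler_characteristic (reverse_edge n P) (next_edge n P) (oriented_edges n))) / 2"

end

theory Submission
  imports Defs
begin

text \<open>
  Write \<open>\<sigma>\<close> for \<open>pi_fat P \<circ> shift n\<close>. Both sides equal \<open>r + t - 1\<close>, where \<open>r\<close> is the number of blocks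
  and \<open>t\<close> the number of cycles of \<open>\<sigma>\<close>. The degree is \<open>t\<close> plus the number of \<open>x\<close> with \<open>\<sigma> x < x\<close>. Such a
  descent occurs exactly if \<open>x - 1 \<ge> 1\<close> is the maximum of its block, so every block except the
  one of \<open>n\<close> contributes one descent. The polyhedron has \<open>2 * n\<close> vertices, \<open>3 * n\<close> edges and
  \<open>1 + r + t\<close> faces.
\<close>

section \<open>Counting orbits\<close>

text \<open>An \<open>orbit\<close> begins with the image of its base point, so membership of
  \<open>x\<close> itself expresses periodicity. Extending \<open>f\<close> from \<open>S\<close> by
  the identity gives a permutation with finite support, which is periodic everywhere; the extension
  does not change orbits that start in \<open>S\<close>.\<close>

lemma self_in_orbit_bij_betw:
  assumes "bij_betw f S S" "finite S" "x \<in> S"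
  shows "x \<in> orbit f x"
proof -
  let ?g = "perm_restrict f S"
  have "bij_betw ?g S S"
    using assms(1) by (subst bij_betw_cong[where g = f]) (simp_all add: perm_restrict_def)
  then have "?g permutes S"
    by (rule bij_imp_permutes) (simp add: perm_restrict_def)
  then have "permutation ?g"
    using assms(2) by (auto simp: permutation_permutes)
  then have "x \<in> orbit ?g x"
    by (rule permutation_self_in_orbit)
  moreover have "orbit f x = orbit ?g x"
    using assms(1,3) by (intro orbit_cong0) (auto simp: perm_restrict_def bij_betw_def)
  ultimately show ?thesis by simp
qed

lemma orbit_subset_closed:
  assumes "x \<in> S" "\<And>y. y \<in> S \<Longrightarrow> f y \<in> S"
  shows "orbit f x \<subseteq> S"
proof
  fix y assume "y \<in> orbit f x"
  then show "y \<in> S" by induct (auto simp: assms)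
qed

lemma orbit_eqI_self_in:
  assumes "x \<in> orbit f x" "y \<in> orbit f x"
  shows "orbit f y = orbit f x"
  using orbit_swap[OF assms] assms(2) by (blast intro: orbit_trans)

text \<open>Since \<open>h\<close> carries one step of \<open>g\<close> to two steps of
  \<open>f\<close>, it maps orbits of \<open>g\<close> into orbits of \<open>f\<close>. This suits
  faces along whose boundary two kinds of edges alternate: \<open>g\<close> then describes every
  other edge.\<close>

lemma orbit_two_step:
  assumes "x \<in> S" "\<And>y. y \<in> S \<Longrightarrow> g y \<in> S" "\<And>y. y \<in> S \<Longrightarrow> f (f (h y)) = h (g y)"
    and "z \<in> orbit g x"
  shows "h z \<in> orbit f (h x)"
  using assms(4)
proof induct
  case base
  show ?case using assms(1,3) by (metis orbit.base orbit.step)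
next
  case (step y)
  have "y \<in> S" using step(1) orbit_subset_closed[of x S g, OF assms(1,2)] by blast
  then show ?case using step(2) assms(3) by (metis orbit.step)
qed

text \<open>Here two steps of \<open>f\<close> undo a step of \<open>g\<close>, so orbits are
  transported with their direction reversed. This is for faces that are traversed against
  \<open>g\<close>.\<close>

lemma orbit_two_step_backwards:
  assumes "x \<in> S" "\<And>y. y \<in> S \<Longrightarrow> g y \<in> S" "\<And>y. y \<in> S \<Longrightarrow> f (f (h (g y))) = h y"
    and "z \<in> orbit g x"
  shows "h x \<in> orbit f (h z)"
  using assms(4)
proof induct
  case base
  show ?case using assms(1,3) by (metis orbit.base orbit.step)
next
  case (step y)
  have "y \<in> S" using step(1) orbit_subset_closed[of x S g, OF assms(1,2)] by blast
  then have "h y \<in> orbit f (h (g y))" using assms(3) by (metis orbit.base orbit.step)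
  then show ?case using step(2) orbit_trans by metis
qed

text \<open>The orbits are exactly the fibres of the invariant \<open>I\<close> on \<open>D\<close>,
  because \<open>I\<close> is constant along \<open>f\<close> and equal values can be joined by
  steps of \<open>f\<close>. Orbits are therefore counted by the values of \<open>I\<close>.\<close>

lemma card_orbits_on_invariant:
  assumes closed: "\<And>d. d \<in> D \<Longrightarrow> f d \<in> D"
    and invariant: "\<And>d. d \<in> D \<Longrightarrow> I (f d) = I d"
    and complete: "\<And>d d'. d \<in> D \<Longrightarrow> d' \<in> D \<Longrightarrow> I d = I d' \<Longrightarrow> d' \<in> orbit f d"
  shows "card (orbits_on f D) = card (I ` D)"
proof -
  have *: "orbit f d = {d' \<in> D. I d' = I d}" if "d \<in> D" for d
  proof -
    have "orbit f d \<subseteq> {d' \<in> D. I d' = I d}"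
      by (rule orbit_subset_closed) (use that in \<open>auto simp: closed invariant\<close>)
    then show ?thesis using complete[OF that] by auto
  qed
  have "orbits_on f D = (\<lambda>v. {d' \<in> D. I d' = v}) ` I ` D"
    unfolding orbits_on_def image_image using * by (intro image_cong) auto
  moreover have "inj_on (\<lambda>v. {d' \<in> D. I d' = v}) (I ` D)"
    by (auto simp: inj_on_def)
  ultimately show ?thesis by (simp add: card_image)
qed

text \<open>Every element of \<open>D\<close> is in \<open>A\<close> or one step after an element of
  \<open>A\<close>, so joining equal values of \<open>I\<close> needs to be checked on
  \<open>A\<close> only.\<close>

lemma card_orbits_on_half:
  assumes closed: "\<And>d. d \<in> D \<Longrightarrow> f d \<in> D"
    and invariant: "\<And>d. d \<in> D \<Longrightarrow> I (f d) = I d"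
    and half: "A \<subseteq> D" "D \<subseteq> A \<union> f ` A"
    and complete: "\<And>a a'. a \<in> A \<Longrightarrow> a' \<in> A \<Longrightarrow> I a = I a' \<Longrightarrow> a' \<in> orbit f a"
  shows "card (orbits_on f D) = card (I ` D)"
proof (rule card_orbits_on_invariant[where f = f and D = D and I = I, OF closed invariant])
  fix d d' assume d: "d \<in> D" "d' \<in> D" "I d = I d'"
  have rep: "\<exists>a\<in>A. I a = I d \<and> (d = a \<or> d = f a)" if "d \<in> D" for d
    using that half invariant by force
  obtain a where a: "a \<in> A" "I a = I d" "d = a \<or> d = f a" using rep[OF d(1)] by blast
  obtain a' where a': "a' \<in> A" "I a' = I d'" "d' = a' \<or> d' = f a'" using rep[OF d(2)] by blast
  \<comment> \<open>Taking \<open>a' = a\<close> in \<open>complete\<close> shows that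
    \<open>a\<close> is periodic, so \<open>a\<close> and \<open>f a\<close> have the same
    orbit.\<close>
  have "a \<in> orbit f a" "a' \<in> orbit f a" using complete a a' d(3) by metis+
  moreover from this have "orbit f (f a) = orbit f a" by (simp add: self_in_orbit_step)
  ultimately show "d' \<in> orbit f d" using a(3) a'(3) by (auto intro: orbit.step)
qed

lemma orbits_on_bij_betw_partition:
  assumes "bij_betw f S S" "finite S"
  shows "partition_on S (orbits_on f S)"
proof -
  have self: "x \<in> orbit f x" if "x \<in> S" for x
    using self_in_orbit_bij_betw[OF assms that] .
  have sub: "orbit f x \<subseteq> S" if "x \<in> S" for x
    using that assms(1) by (intro orbit_subset_closed) (auto simp: bij_betw_def)
  show ?thesis
  proof (rule partition_onI)
    show "\<Union> (orbits_on f S) = S" using self sub by (auto simp: orbits_on_def)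
    show "{} \<notin> orbits_on f S" using self by (auto simp: orbits_on_def)
    fix p q assume "p \<in> orbits_on f S" "q \<in> orbits_on f S" "p \<noteq> q"
    then show "disjnt p q"
      unfolding orbits_on_def disjnt_iff using self orbit_eqI_self_in by (metis imageE)
  qed
qed


section \<open>The cyclic successor\<close>

lemma cyclic_succ_in:
  assumes "finite B" "x \<in> B"
  shows "cyclic_succ B x \<in> B"
proof (cases "\<exists>y\<in>B. x < y")
  case True
  then have "Min {y \<in> B. x < y} \<in> {y \<in> B. x < y}" using assms by (intro Min_in) auto
  then show ?thesis using True by (simp add: cyclic_succ_def)
next
  case False
  moreover have "Min B \<in> B" using assms by (intro Min_in) auto
  ultimately show ?thesis by (simp add: cyclic_succ_def)
qed

text \<open>The successor moves strictly up except at the maximum, where it wraps to the minimum.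
  The inequality is weak because of singletons, whose only point is fixed.\<close>

lemma cyclic_succ_le_iff:
  assumes "finite B" "x \<in> B"
  shows "cyclic_succ B x \<le> x \<longleftrightarrow> x = Max B"
proof (cases "\<exists>y\<in>B. x < y")
  case True
  then have "Min {y \<in> B. x < y} \<in> {y \<in> B. x < y}" using assms by (intro Min_in) auto
  moreover have "x \<noteq> Max B" using True assms by (metis Max_ge leD)
  ultimately show ?thesis using True by (simp add: cyclic_succ_def)
next
  case False
  then have "x = Max B" using assms by (intro Max_eqI[symmetric]) (auto simp: not_less)
  then show ?thesis using False assms by (auto simp: cyclic_succ_def)
qed

text \<open>From \<open>x\<close> climb to the maximum, wrap to the minimum, and climb to
  \<open>y\<close>; this also covers \<open>x = y\<close>. The climb \<open>up\<close> is by
  induction on the distance still to go.\<close>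

lemma orbit_cyclic_succ:
  assumes B: "finite B" and x: "x \<in> B" and y: "y \<in> B"
  shows "y \<in> orbit (cyclic_succ B) x"
proof -
  let ?s = "cyclic_succ B"
  have up: "y \<in> orbit ?s x" if "x \<in> B" "y \<in> B" "x < y" for x y
    using that
  proof (induction "y - x" arbitrary: x rule: less_induct)
    case less
    let ?z = "Min {y \<in> B. x < y}"
    have z: "?s x = ?z" using less.prems by (auto simp: cyclic_succ_def)
    have mem: "?z \<in> {y \<in> B. x < y}" using B less.prems by (intro Min_in) auto
    have le: "?z \<le> y" using B less.prems by (intro Min_le) auto
    show ?case
    proof (cases "?z = y")
      case True
      then show ?thesis using z orbit.base by metis
    next
      case False
      then have "y \<in> orbit ?s ?z" using mem le less.prems by (intro less.hyps) auto
      then show ?thesis using z orbit_subset by metis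
    qed
  qed
  have "B \<noteq> {}" using x by blast
  then have Max: "Max B \<in> B" and Min: "Min B \<in> B" using B by simp_all
  have s_Max: "?s (Max B) = Min B" using B x by (auto simp: cyclic_succ_def dest: leD[OF Max_ge])
  have "Min B \<in> orbit ?s x"
  proof (cases "x = Max B")
    case True
    then show ?thesis using s_Max orbit.base by metis
  next
    case False
    then have "x < Max B" using B x by (simp add: order.not_eq_order_implies_strict)
    then show ?thesis using up[OF x Max] s_Max orbit.step by metis
  qed
  moreover have "y \<in> orbit ?s (Min B)" if "y \<noteq> Min B"
    using B y that by (intro up Min) (simp_all add: order.not_eq_order_implies_strict)
  ultimately show ?thesis using orbit_trans by metis
qed

lemma bij_betw_cyclic_succ:
  assumes "finite B"
  shows "bij_betw (cyclic_succ B) B B"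
proof -
  have "B \<subseteq> cyclic_succ B ` B"
  proof
    fix y assume y: "y \<in> B"
    have "orbit (cyclic_succ B) y \<subseteq> B"
      using y cyclic_succ_in[OF assms] by (rule orbit_subset_closed)
    \<comment> \<open>Since \<open>y\<close> lies in its own orbit, it is the image of an element of
      that orbit, which stays in \<open>B\<close>. Surjectivity on a finite set then gives
      injectivity.\<close>
    with orbit_cyclic_succ[OF assms y y] show "y \<in> cyclic_succ B ` B"
      using y by cases auto
  qed
  then have "cyclic_succ B ` B = B" using cyclic_succ_in[OF assms] by auto
  then show ?thesis using assms by (simp add: bij_betw_def eq_card_imp_inj_on)
qed

text \<open>This is the one-block case, which describes the walk around the hole;
  \<open>orbit_cyclic_succ\<close> thus shows that the hole has a single boundary cycle.\<close>

lemma cyclic_succ_interval: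
  assumes "k \<in> {1..n}"
  shows "cyclic_succ {1..n} k = (if k = n then 1 else k + 1)"
proof (cases "k = n")
  case True
  then show ?thesis using assms by (auto simp: cyclic_succ_def intro!: Min_eqI)
next
  case False
  then have "Min {y \<in> {1..n}. k < y} = k + 1" using assms by (intro Min_eqI) auto
  then show ?thesis using False assms by (auto simp: cyclic_succ_def)
qed


section \<open>The permutation of a partition\<close>

context
  fixes n :: nat and P :: "nat set set"
  assumes n: "n \<ge> 1" and P: "partition_on {1..n} P"
begin

text \<open>Dropping the primes turns \<open>pi_fat P\<close> into a self-map of
  \<open>{1..n}\<close>, whose orbits are the blocks.\<close>

private abbreviation "s k \<equiv> pi_fat P (Prime k)"

private abbreviation "\<sigma> \<equiv> pi_fat P \<circ> shift n"

lemma block_of_eq: "B \<in> P \<Longrightarrow> k \<in> B \<Longrightarrow> block_of P k = B"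
  unfolding block_of_def using partition_onD2[OF P] by (auto simp: disjoint_def intro!: the_equality)

lemma block_of_in:
  assumes "k \<in> {1..n}"
  shows "block_of P k \<in> P" "k \<in> block_of P k"
proof -
  obtain B where "B \<in> P" "k \<in> B" using assms partition_onD1[OF P] by blast
  moreover from this have "block_of P k = B" by (rule block_of_eq)
  ultimately show "block_of P k \<in> P" "k \<in> block_of P k" by simp_all
qed

lemma finite_block: "B \<in> P \<Longrightarrow> finite B"
  using partition_onD1[OF P] finite_subset[of B "{1..n}"] by blast

lemma block_subset: "B \<in> P \<Longrightarrow> B \<subseteq> {1..n}"
  using partition_onD1[OF P] by blast

lemma block_nonempty: "B \<in> P \<Longrightarrow> B \<noteq> {}"
  using partition_onD3[OF P] by blast

lemma pi_fat_in_block: "B \<in> P \<Longrightarrow> k \<in> B \<Longrightarrow> s k \<in> B"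
  by (simp add: block_of_eq[of B k] cyclic_succ_in finite_block)

lemma block_of_pi_fat: "k \<in> {1..n} \<Longrightarrow> block_of P (s k) = block_of P k"
  using block_of_eq pi_fat_in_block block_of_in by metis

lemma pi_fat_in: "k \<in> {1..n} \<Longrightarrow> s k \<in> {1..n}"
  using pi_fat_in_block block_of_in block_subset by blast

lemma bij_betw_pi_fat: "bij_betw s {1..n} {1..n}"
proof -
  have "{1..n} \<subseteq> s ` {1..n}"
  proof
    fix y assume y: "y \<in> {1..n}"
    let ?B = "block_of P y"
    have B: "?B \<in> P" "y \<in> ?B" using y block_of_in by auto
    then obtain x where x: "x \<in> ?B" "y = cyclic_succ ?B x"
      using bij_betw_cyclic_succ[OF finite_block] by (metis bij_betw_imp_surj_on imageE)
    then have "y = s x" using B by (simp add: block_of_eq[of ?B x])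
    then show "y \<in> s ` {1..n}" using x B block_subset by blast
  qed
  then have "s ` {1..n} = {1..n}" using pi_fat_in by auto
  then show ?thesis by (simp add: bij_betw_def eq_card_imp_inj_on)
qed

lemma orbit_pi_fat:
  assumes "B \<in> P" "k \<in> B" "l \<in> B"
  shows "l \<in> orbit s k"
proof -
  have "orbit s k = orbit (cyclic_succ B) k"
    using assms block_of_eq[OF assms(1)] cyclic_succ_in[OF finite_block]
    by (intro orbit_cong0[where A = B]) auto
  then show ?thesis using orbit_cyclic_succ finite_block assms by blast
qed

lemma bij_betw_shift: "bij_betw (shift n) {1..n} (Prime ` {1..n})"
proof (rule bij_betw_byWitness[where f' = "\<lambda>p. case p of Prime k \<Rightarrow> if k = n then 1 else k + 1"])
  show "shift n ` {1..n} \<subseteq> Prime ` {1..n}" using n by (auto simp: shift_def intro!: imageI)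
qed (use n in \<open>auto simp: shift_def\<close>)

lemma bij_betw_pi_fat_primed: "bij_betw (pi_fat P) (Prime ` {1..n}) {1..n}"
proof -
  have "bij_betw Prime {1..n} (Prime ` {1..n})" by (auto simp: bij_betw_def inj_on_def)
  then show ?thesis
    using bij_betw_pi_fat bij_betw_comp_iff[of Prime "{1..n}" "Prime ` {1..n}" "pi_fat P" "{1..n}"]
    by (simp add: comp_def)
qed

lemma bij_betw_sigma: "bij_betw \<sigma> {1..n} {1..n}"
  using bij_betw_shift bij_betw_pi_fat_primed by (rule bij_betw_trans)

lemma inv_into_pi_fat: "p \<in> Prime ` {1..n} \<Longrightarrow> inv_into (Prime ` {1..n}) (pi_fat P) (pi_fat P p) = p"
  using bij_betw_pi_fat_primed by (simp add: bij_betw_def)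

lemma pi_fat_inv_into: "k \<in> {1..n} \<Longrightarrow> pi_fat P (inv_into (Prime ` {1..n}) (pi_fat P) k) = k"
  using bij_betw_pi_fat_primed by (simp add: bij_betw_def f_inv_into_f)

lemma inv_into_in: "k \<in> {1..n} \<Longrightarrow> inv_into (Prime ` {1..n}) (pi_fat P) k \<in> Prime ` {1..n}"
  using bij_betw_pi_fat_primed by (simp add: bij_betw_def inv_into_into)

section \<open>Descents and the degree\<close>

lemma card_descents: "card {x \<in> {1..n}. \<sigma> x < x} = card P - 1"
proof -
  let ?Q = "P - {block_of P n}"
  have n_in: "n \<in> {1..n}" using n by simp
  have Max_in: "Max B \<in> B" if "B \<in> P" for B
    using that finite_block block_nonempty by simp
  have Max_less: "Max B < n" if "B \<in> ?Q" for B
  proof -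
    have "Max B \<noteq> n" using that Max_in[of B] block_of_eq[of B n] by auto
    then show ?thesis using that Max_in[of B] block_subset[of B] by force
  qed
  have "{x \<in> {1..n}. \<sigma> x < x} = (\<lambda>B. Suc (Max B)) ` ?Q"
  proof (intro equalityI subsetI)
    fix x assume "x \<in> {x \<in> {1..n}. \<sigma> x < x}"
    then have x: "x \<in> {1..n}" "\<sigma> x < x" by auto
    \<comment> \<open>The point \<open>1\<close> is shifted to the primed copy of \<open>n\<close>,
      and its image is at least \<open>1\<close>, so it is not a descent.\<close>
    have "x \<noteq> 1"
      using x pi_fat_in[OF n_in] by (auto simp: shift_def)
    \<comment> \<open>For \<open>x > 1\<close> the value \<open>\<sigma> x\<close> is
      \<open>s (x - 1)\<close>, so the strict descent at \<open>x\<close> becomes a weak one at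
      \<open>x - 1\<close>, as in \<open>cyclic_succ_le_iff\<close>.\<close>
    then have x1: "x - 1 \<in> {1..n}" "x - 1 < n" "s (x - 1) \<le> x - 1"
      using x by (auto simp: shift_def)
    let ?B = "block_of P (x - 1)"
    have B: "?B \<in> P" "x - 1 \<in> ?B" using block_of_in x1(1) by auto
    have "x - 1 = Max ?B"
      using x1(3) cyclic_succ_le_iff[OF finite_block[OF B(1)] B(2)] by simp
    moreover have "?B \<noteq> block_of P n"
      using \<open>x - 1 = Max ?B\<close> x1(2) block_of_in(2)[OF n_in] Max_ge[OF finite_block[OF B(1)]]
      by (metis leD)
    ultimately show "x \<in> (\<lambda>B. Suc (Max B)) ` ?Q"
      using B x(1) by (intro image_eqI[of _ _ ?B]) auto
  next
    fix x assume "x \<in> (\<lambda>B. Suc (Max B)) ` ?Q"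
    then obtain B where B: "B \<in> ?Q" "x = Suc (Max B)" by blast
    have M: "Max B \<in> B" "Max B < n" "Max B \<in> {1..n}"
      using B Max_in[of B] Max_less[of B] block_subset[of B] by (auto simp del: One_nat_def)
    have "s (Max B) \<le> Max B"
      using B M cyclic_succ_le_iff[of B "Max B"] finite_block by (simp add: block_of_eq[of B])
    then show "x \<in> {x \<in> {1..n}. \<sigma> x < x}"
      using B M by (auto simp: shift_def)
  qed
  \<comment> \<open>The maximum lies in its block, and a block is recovered from any of its points
    by \<open>block_of\<close>.\<close>
  moreover have "inj_on (\<lambda>B. Suc (Max B)) ?Q"
    by (rule inj_onI) (metis DiffD1 Max_in block_of_eq nat.inject)
  ultimately show ?thesis
    using block_of_in(1)[OF n_in] by (simp add: card_image)
qed

lemma fat_cycles_partition: "partition_on {1..n} (fat_cycles n P)"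
  unfolding fat_cycles_def using orbits_on_bij_betw_partition[OF bij_betw_sigma] by simp

text \<open>Clockwise winds are weak ascents, so the index of a cycle counts its strict descents.
  The cycles partition \<open>{1..n}\<close>: the indices add up to the number of all descents, and
  the extra \<open>1\<close> per index counts the cycles.\<close>

lemma deg_indicator: "deg (indicator_of_partition n P) = card P - 1 + card (fat_cycles n P)"
proof -
  let ?C = "fat_cycles n P"
  have fin: "finite ?C" using finite_elements[OF _ fat_cycles_partition] by simp
  have U: "\<Union>?C = {1..n}" using partition_onD1[OF fat_cycles_partition] by simp
  have finb: "finite b" if "b \<in> ?C" for b
    using that U finite_subset[of b "{1..n}"] by blast
  have ci: "cycle_index n P b = card {x \<in> b. \<sigma> x < x}" if "b \<in> ?C" for b
  proof -
    have "card b = card ({x \<in> b. x \<le> \<sigma> x} \<union> {x \<in> b. \<sigma> x < x})"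
      by (rule arg_cong[of _ _ card]) auto
    also have "\<dots> = card {x \<in> b. x \<le> \<sigma> x} + card {x \<in> b. \<sigma> x < x}"
      using finb[OF that] by (intro card_Un_disjoint) auto
    finally show ?thesis by (simp add: cycle_index_def clockwise_winds_def)
  qed
  have "deg (indicator_of_partition n P) = (\<Sum>b\<in>?C. cycle_index n P b + 1)"
    by (simp add: indicator_of_partition_def sum_unfold_sum_mset image_mset.compositionality comp_def)
  also have "\<dots> = (\<Sum>b\<in>?C. card {x \<in> b. \<sigma> x < x}) + card ?C"
    by (simp only: sum.distrib) (simp add: ci)
  also have "(\<Sum>b\<in>?C. card {x \<in> b. \<sigma> x < x}) = card (\<Union>b\<in>?C. {x \<in> b. \<sigma> x < x})"
    using fin finb partition_onD2[OF fat_cycles_partition]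
    by (intro card_UN_disjoint[symmetric]) (auto simp: disjoint_def)
  also have "(\<Union>b\<in>?C. {x \<in> b. \<sigma> x < x}) = {x \<in> {1..n}. \<sigma> x < x}"
    using U by auto
  finally show ?thesis using card_descents by simp
qed


section \<open>The Euler characteristic\<close>

private abbreviation "D \<equiv> oriented_edges n"
private abbreviation "e \<equiv> reverse_edge n P"
private abbreviation "f \<equiv> next_edge n P"

section \<open>Reversing and turning oriented edges\<close>

lemma oriented_edges_cases:
  assumes "d \<in> D"
  obtains (unprimed) k a where "k \<in> {1..n}" "d = (Inl k, a)"
  | (primed) k a where "k \<in> {1..n}" "d = (Inr (Prime k), a)"
  using assms by (auto simp: oriented_edges_def)

lemma in_oriented_edges [simp]:
  "(Inl k, a) \<in> D \<longleftrightarrow> k \<in> {1..n}" "(Inr (Prime k), a) \<in> D \<longleftrightarrow> k \<in> {1..n}"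
  by (cases a; auto simp: oriented_edges_def)+

text \<open>The kind \<open>b\<close> is arbitrary because membership in \<open>D\<close> depends on
  the origin only. This serves both \<open>reverse_edge\<close>, which keeps the kind, and
  \<open>next_edge\<close>, which changes it.\<close>

lemma opposite_end_in:
  assumes "(p, a) \<in> D"
  shows "(opposite_end n P a p, b) \<in> D"
proof -
  have *: "(Inr q, b) \<in> D" if "q \<in> Prime ` {1..n}" for q
    using that by auto
  from assms show ?thesis
  proof (cases rule: oriented_edges_cases)
    case (unprimed k c)
    then show ?thesis
      using * inv_into_in[of k] bij_betw_apply[OF bij_betw_shift, of k]
      by (cases a) (simp_all del: One_nat_def)
  next
    case (primed k c)
    then show ?thesis
      using n pi_fat_in[of k] by (cases a) (auto simp del: pi_fat.simps)
  qed
qed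

lemma opposite_end_opposite_end:
  assumes "(p, a) \<in> D"
  shows "opposite_end n P a (opposite_end n P a p) = p"
  using assms
proof (cases rule: oriented_edges_cases)
  case (unprimed k b)
  then show ?thesis
    by (cases a) (auto simp: shift_def pi_fat_inv_into simp del: pi_fat.simps One_nat_def)
next
  case (primed k b)
  then show ?thesis
    by (cases a) (auto simp: shift_def inv_into_pi_fat simp del: pi_fat.simps One_nat_def)
qed

text \<open>Reversing an edge and then continuing along the face crosses the same edge twice, so the
  origin returns and only the kind turns.\<close>

lemma next_edge_reverse_edge:
  assumes "(p, a) \<in> D"
  shows "(f \<circ> e) (p, a) = (p, turn p a)"
  using opposite_end_opposite_end[OF assms] by simp

text \<open>The origin is a complete invariant: \<open>f \<circ> e\<close> fixes it and permutes the
  three kinds cyclically.\<close>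

lemma card_vertices: "card (orbits_on (f \<circ> e) D) = 2 * n"
proof -
  have "card (orbits_on (f \<circ> e) D) = card (fst ` D)"
  proof (rule card_orbits_on_invariant)
    fix d d' assume d: "d \<in> D" "d' \<in> D" "fst d = fst d'"
    obtain p a b where dd: "d = (p, a)" "d' = (p, b)" using d(3) by (cases d; cases d') auto
    have D: "(p, c) \<in> D" for c
      using d(1) dd by (cases rule: oriented_edges_cases) auto
    have 1: "(p, turn p a) \<in> orbit (f \<circ> e) (p, a)"
      using next_edge_reverse_edge[OF D] by (metis orbit.base)
    have 2: "(p, turn p (turn p a)) \<in> orbit (f \<circ> e) (p, a)"
      using next_edge_reverse_edge[OF D] 1 by (metis orbit.step)
    have 3: "(p, turn p (turn p (turn p a))) \<in> orbit (f \<circ> e) (p, a)"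
      using next_edge_reverse_edge[OF D] 2 by (metis orbit.step)
    \<comment> \<open>For each \<open>p\<close>, \<open>turn p\<close> is a 3-cycle, so one to three
      turns reach every kind, the last one returning to \<open>a\<close>.\<close>
    have "b \<in> {turn p a, turn p (turn p a), turn p (turn p (turn p a))}"
      by (cases p; cases a; cases b) auto
    with 1 2 3 show "d' \<in> orbit (f \<circ> e) d" using dd by auto
  next
    fix d assume "d \<in> D"
    then show "(f \<circ> e) d \<in> D" "fst ((f \<circ> e) d) = fst d"
      using next_edge_reverse_edge[of "fst d" "snd d"]
      by (cases rule: oriented_edges_cases; simp)+
  qed
  also have "fst ` D = {1..n} <+> Prime ` {1..n}"
    by (auto simp: oriented_edges_def fst_image_times)
  also have "card \<dots> = 2 * n"
    by (simp add: card_Plus card_image inj_on_def)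
  finally show ?thesis .
qed

text \<open>Each edge has exactly one unprimed end, which determines it together with the kind.\<close>

fun unprimed_end :: "point \<times> edge_kind \<Rightarrow> point \<times> edge_kind" where
  "unprimed_end (Inl k, a) = (Inl k, a)"
| "unprimed_end (Inr p, a) = e (Inr p, a)"

text \<open>The representatives \<open>?A\<close> are the edges with unprimed origin. On them
  \<open>unprimed_end\<close> is the identity, so its values are exactly \<open>?A\<close>:
  \<open>n\<close> origins times three kinds.\<close>

lemma card_edges: "card (orbits_on e D) = 3 * n"
proof -
  let ?A = "Inl ` {1..n} \<times> {Block_Arc, Gap_Arc, Line} :: (point \<times> edge_kind) set"
  have ee: "e (e d) = d" if "d \<in> D" for d
    using opposite_end_opposite_end[of "fst d" "snd d"] that by (cases d) simp
  have eD: "e d \<in> D" if "d \<in> D" for d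
    using opposite_end_in[of "fst d" "snd d" "snd d"] that by (cases d) simp
  have Inl: "\<exists>k. e (Inr p, a) = (Inl k, a)" for p a
    by (cases p; cases a) auto
  have Inr: "\<exists>p. e (Inl k, a) = (Inr p, a)" for k a
    by (cases a) auto
  have A: "d \<in> ?A" if "d \<in> D" "fst d = Inl k" for d k
    using that by (auto simp: oriented_edges_def)
  have ue: "unprimed_end d \<in> ?A" if "d \<in> D" for d
    using that eD[OF that] Inl[of "projr (fst d)" "snd d"] A[of "unprimed_end d"]
    by (cases d rule: unprimed_end.cases) auto
  have half: "?A \<subseteq> D" by (auto simp: oriented_edges_def)
  have "card (orbits_on e D) = card (unprimed_end ` D)"
  proof (rule card_orbits_on_half[OF eD _ half])
    fix d assume d: "d \<in> D"
    then show "unprimed_end (e d) = unprimed_end d"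
      using ee[OF d] Inl Inr
      by (cases d rule: unprimed_end.cases) (metis unprimed_end.simps)+
  next
    show "D \<subseteq> ?A \<union> e ` ?A"
    proof
      fix d assume d: "d \<in> D"
      have "d = unprimed_end d \<or> d = e (unprimed_end d)"
        using ee[OF d] by (cases d rule: unprimed_end.cases) simp_all
      then show "d \<in> ?A \<union> e ` ?A"
        using ue[OF d] by (metis UnI1 UnI2 image_eqI)
    qed
  next
    fix a a' assume a: "a \<in> ?A" "a' \<in> ?A" "unprimed_end a = unprimed_end a'"
    then have "a' = a" by auto
    then show "a' \<in> orbit e a"
      using ee[of a] a(1) half by (metis orbit.base orbit.step subsetD)
  qed
  also have "unprimed_end ` D = ?A"
  proof
    show "?A \<subseteq> unprimed_end ` D"
    proof
      fix a assume a: "a \<in> ?A"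
      then have "a = unprimed_end a" by auto
      then show "a \<in> unprimed_end ` D" using a half by blast
    qed
    show "unprimed_end ` D \<subseteq> ?A" using ue by (rule image_subsetI)
  qed
  also have "card ?A = 3 * n"
    by (simp add: card_cartesian_product card_image inj_on_def)
  finally show ?thesis .
qed

text \<open>The face on the left of an oriented edge: the sphere with a hole, the disc of a block, or the
  disc of a cycle. The first component keeps these three sorts apart, since a cycle may coincide
  with a block as a set.\<close>

fun face :: "point \<times> edge_kind \<Rightarrow> edge_kind \<times> nat set" where
  "face (Inl k, Block_Arc) = (Gap_Arc, {})"
| "face (Inr p, Gap_Arc) = (Gap_Arc, {})"
| "face (Inr (Prime k), Block_Arc) = (Block_Arc, block_of P k)"
| "face (Inl k, Line) = (Block_Arc, block_of P k)"
| "face (Inl k, Gap_Arc) = (Line, orbit \<sigma> k)"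
| "face (Inr p, Line) = (Line, orbit \<sigma> (pi_fat P p))"

text \<open>The invariant is \<open>face\<close>. Two kinds of edges alternate along each boundary,
  and \<open>?A\<close> keeps one of them: \<open>?A1\<close> for the hole, \<open>?A2\<close> for
  the blocks, \<open>?A3\<close> for the cycles. On these, \<open>f \<circ> f\<close> acts as the
  rotation of \<open>{1..n}\<close>, the inverse of \<open>s\<close>, and \<open>\<sigma>\<close>,
  respectively.\<close>

lemma card_faces: "card (orbits_on f D) = 1 + card P + card (fat_cycles n P)"
proof -
  let ?N = "{1..n}"
  let ?A1 = "(\<lambda>k. (Inl k, Block_Arc)) ` ?N"
  let ?A2 = "(\<lambda>k. (Inr (Prime k), Block_Arc)) ` ?N"
  let ?A3 = "(\<lambda>k. (Inl k, Gap_Arc)) ` ?N"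
  let ?A = "?A1 \<union> ?A2 \<union> ?A3"
  have fD: "f d \<in> D" if "d \<in> D" for d
    using opposite_end_in[of "fst d" "snd d"] that by (cases d) (simp add: Let_def)
  have s_surj: "\<exists>l\<in>?N. k = s l" if "k \<in> ?N" for k
    using that bij_betw_pi_fat by (metis bij_betw_imp_surj_on imageE)
  have shift_surj: "\<exists>l\<in>?N. Prime k = shift n l" if "k \<in> ?N" for k
    using that bij_betw_shift by (metis bij_betw_imp_surj_on imageE imageI)
  have sigma_in: "\<sigma> k \<in> ?N" if "k \<in> ?N" for k
    using that bij_betw_sigma by (rule bij_betw_apply[rotated])
  have self: "k \<in> orbit \<sigma> k" if "k \<in> ?N" for k
    using bij_betw_sigma _ that by (rule self_in_orbit_bij_betw) simp
  have f_line: "f (Inl (s k), Line) = (Inr (Prime k), Block_Arc)" if "k \<in> ?N" for k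
    using that inv_into_pi_fat[of "Prime k"] by (simp add: Let_def del: pi_fat.simps)
  have "card (orbits_on f D) = card (face ` D)"
  proof (rule card_orbits_on_half[OF fD])
    fix d assume "d \<in> D"
    then show "face (f d) = face d"
    proof (cases rule: oriented_edges_cases)
      case (unprimed k a)
      show ?thesis
      proof (cases a)
        case Gap_Arc
        then show ?thesis using unprimed self_in_orbit_step[OF self] by simp
      next
        case Line
        \<comment> \<open>Writing \<open>k\<close> as an image makes the \<open>inv_into\<close> in
          the opposite end of a line computable.\<close>
        obtain l where l: "l \<in> ?N" "k = s l" using s_surj unprimed by blast
        then show ?thesis
          using Line unprimed f_line block_of_pi_fat by (simp del: pi_fat.simps next_edge.simps)
      qed (use unprimed in simp)
    next
      case (primed k a)
      then show ?thesis by (cases a) (simp_all del: pi_fat.simps)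
    qed
  next
    show "?A \<subseteq> D" by auto
  next
    show "D \<subseteq> ?A \<union> f ` ?A"
    proof
      fix d assume "d \<in> D"
      then show "d \<in> ?A \<union> f ` ?A"
      proof (cases rule: oriented_edges_cases)
        case (unprimed k a)
        have "f (Inr (Prime k), Block_Arc) = (Inl k, Line)" by simp
        then have "(Inl k, Line) \<in> f ` ?A2" using unprimed by (metis image_eqI)
        then show ?thesis using unprimed by (cases a) auto
      next
        case (primed k a)
        have "f (Inl k, Block_Arc) = (Inr (Prime k), Gap_Arc)" by simp
        then have 1: "(Inr (Prime k), Gap_Arc) \<in> f ` ?A1" using primed by (metis image_eqI)
        obtain l where l: "l \<in> ?N" "Prime k = shift n l" using shift_surj primed by blast
        then have "f (Inl l, Gap_Arc) = (Inr (Prime k), Line)" by simp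
        then have 2: "(Inr (Prime k), Line) \<in> f ` ?A3" using l by (metis image_eqI)
        show ?thesis using 1 2 primed by (cases a) auto
      qed
    qed
  next
    fix a a' assume aa: "a \<in> ?A" "a' \<in> ?A" "face a = face a'"
    have 1: "(Inl l, Block_Arc) \<in> orbit f (Inl k, Block_Arc)" if "k \<in> ?N" "l \<in> ?N" for k l
      using that
      by (intro orbit_two_step[where h = "\<lambda>k. (Inl k, Block_Arc)" and S = ?N and
            g = "cyclic_succ ?N"] orbit_cyclic_succ cyclic_succ_in)
        (auto simp: cyclic_succ_interval simp del: One_nat_def)
    \<comment> \<open>The disc of a block is traversed against \<open>s\<close>, so the path from
      \<open>k\<close> to \<open>l\<close> along the face comes from the \<open>s\<close>-orbit of
      \<open>l\<close> reaching \<open>k\<close>.\<close>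
    have 2: "(Inr (Prime l), Block_Arc) \<in> orbit f (Inr (Prime k), Block_Arc)"
      if "k \<in> ?N" "l \<in> ?N" "block_of P k = block_of P l" for k l
    proof (rule orbit_two_step_backwards[where h = "\<lambda>k. (Inr (Prime k), Block_Arc)" and S = ?N
          and g = s])
      show "f (f (Inr (Prime (s y)), Block_Arc)) = (Inr (Prime y), Block_Arc)" if "y \<in> ?N" for y
        using f_line[OF that] by simp
      show "k \<in> orbit s l"
        using that block_of_in by (intro orbit_pi_fat[of "block_of P k"]) metis+
    qed (use that pi_fat_in in auto)
    have 3: "(Inl l, Gap_Arc) \<in> orbit f (Inl k, Gap_Arc)"
      if "k \<in> ?N" "l \<in> ?N" "orbit \<sigma> k = orbit \<sigma> l" for k l
      using that self[of l] sigma_in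
      by (intro orbit_two_step[where h = "\<lambda>k. (Inl k, Gap_Arc)" and S = ?N and g = \<sigma>]) auto
    \<comment> \<open>The first component of \<open>face\<close> rules out representatives of
      different sorts.\<close>
    show "a' \<in> orbit f a"
      using aa 1 2 3 by auto
  qed
  also have "face ` D = {(Gap_Arc, {})} \<union> Pair Block_Arc ` P \<union> Pair Line ` fat_cycles n P"
    (is "_ = ?R")
  proof
    show "face ` D \<subseteq> ?R"
    proof (rule image_subsetI)
      fix d assume "d \<in> D"
      then show "face d \<in> ?R"
      proof (cases rule: oriented_edges_cases)
        case (unprimed k a)
        then show ?thesis
          using block_of_in by (cases a) (auto simp: fat_cycles_def orbits_on_def)
      next
        case (primed k a)
        then show ?thesis
          using block_of_in pi_fat_in
          by (cases a) (auto simp: fat_cycles_def orbits_on_def simp del: pi_fat.simps)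
      qed
    qed
    have "(Gap_Arc, {}) \<in> face ` D"
      using n by (intro image_eqI[of _ _ "(Inl 1, Block_Arc)"]) auto
    moreover have "(Block_Arc, B) \<in> face ` D" if B: "B \<in> P" for B
    proof -
      obtain k where "k \<in> B" using block_nonempty[OF B] by blast
      then show ?thesis
        using block_subset[OF B] block_of_eq[OF B] by (intro image_eqI[of _ _ "(Inl k, Line)"]) auto
    qed
    moreover have "(Line, orbit \<sigma> k) \<in> face ` D" if "k \<in> ?N" for k
      using that by (intro image_eqI[of _ _ "(Inl k, Gap_Arc)"]) auto
    ultimately show "?R \<subseteq> face ` D" by (auto simp: fat_cycles_def orbits_on_def)
  qed
  also have "card ?R = 1 + card P + card (fat_cycles n P)"
  proof -
    have "finite P" "finite (fat_cycles n P)"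
      using finite_elements[OF _ P] finite_elements[OF _ fat_cycles_partition] by simp_all
    then show ?thesis
      by (subst card_Un_disjoint; (subst card_Un_disjoint)?)
        (auto simp: card_image inj_on_def)
  qed
  finally show ?thesis .
qed

text \<open>The Euler characteristic is \<open>2 * n - 3 * n + (1 + r + t)\<close>, with
  \<open>r\<close> blocks and \<open>t\<close> cycles.\<close>

lemma genus_eq: "genus n P = (real n + 1 - real (card P) - real (card (fat_cycles n P))) / 2"
  by (simp add: genus_def euler_characteristic_def card_vertices card_edges card_faces)

end

theorem proposition3p4:
  fixes n :: nat and P :: "nat set set"
  assumes "n \<ge> 1" and "partition_on {1..n} P"
  shows "real (deg (indicator_of_partition n P)) = real n - 2 * genus n P"
proof -
  \<comment> \<open>As there is at least one block, the subtraction in \<open>card P - 1\<close> is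
    not truncated and carries over to the reals.\<close>
  have "P \<noteq> {}" using assms by (auto simp: partition_on_def)
  then have "card P \<ge> 1"
    using finite_elements[OF _ assms(2)] by (simp add: Suc_le_eq card_gt_0_iff)
  then show ?thesis
    by (simp add: deg_indicator[OF assms] genus_eq[OF assms] of_nat_diff field_simps)
qed

end
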